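(* Let $a\leq b$ be positive integers and let $n=ab\ge 2$. If $b$ is odd, then $\mathrm{MiD}(L_{a,b})\geq \frac{n-a}{2}$.
   Context: A Latin square of order $n$ is an $n\times n$ array with entries from $\{1,2,\dots,n\}$ such that each row and each column contains every symbol exactly once. For positive integers $a,b$ and $n=ab$, an $(a,b)$-Sudoku Latin square is a Latin square of order $n$ such that, when the array is tiled by $a\times b$ blocks ($a$ consecutive rows $ka+1,\dots,(k+1)a$ by $b$ consecutive columns $lb+1,\dots,(l+1)b$), each block contains every symbol of $\{1,\dots,n\}$ exactly once. Two cells are adjacent if they share an edge horizontally or vertically (no wrap-around). The distance between two adjacent cells containing symbols $u,v$ is $\min\{(u-v)\bmod n,\ (v-u)\bmod n\}$, residues being taken in $\{0,\dots,n-1\}$. The inner distance of a Latin square of order $n\ge2$ is the minimum of the distances over all pairs of adjacent cells. $\mathrm{MiD}(L_{a,b})$ denotes the maximum of the inner distances of all $(a,b)$-Sudoku Latin squares. *)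

theory Defs
  imports Complex_Main
begin

text \<open>
  An array of order \<open>n\<close> is a function \<open>L\<close> whose entry in row \<open>i\<close>, column \<open>j\<close> is \<open>L i j\<close>;
  only the values with \<open>i, j \<in> {1..n}\<close> are ever constrained or inspected.
  A family of cells containing every symbol of \<open>{1..n}\<close> exactly once, and nothing else,
  is expressed by \<^const>\<open>bij_betw\<close>.
\<close>

definition latin_square :: "nat \<Rightarrow> (nat \<Rightarrow> nat \<Rightarrow> nat) \<Rightarrow> bool" where
  "latin_square n L \<longleftrightarrow>
     (\<forall>i\<in>{1..n}. bij_betw (\<lambda>j. L i j) {1..n} {1..n}) \<and>
     (\<forall>j\<in>{1..n}. bij_betw (\<lambda>i. L i j) {1..n} {1..n})"

text \<open>
  An array of order \<open>a * b\<close> has \<open>b\<close> bands of \<open>a\<close> consecutive rows and \<open>a\<close> bands of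
  \<open>b\<close> consecutive columns, hence the ranges of \<open>k\<close> and \<open>l\<close>.
\<close>

definition sudoku_latin_square :: "nat \<Rightarrow> nat \<Rightarrow> (nat \<Rightarrow> nat \<Rightarrow> nat) \<Rightarrow> bool" where
  "sudoku_latin_square a b L \<longleftrightarrow>
     latin_square (a * b) L \<and>
     (\<forall>k<b. \<forall>l<a.
        bij_betw (\<lambda>(i, j). L i j)
          ({k * a + 1..(k + 1) * a} \<times> {l * b + 1..(l + 1) * b}) {1..a * b})"

definition adjacent :: "nat \<times> nat \<Rightarrow> nat \<times> nat \<Rightarrow> bool" where
  "adjacent c d \<longleftrightarrow>
     fst c = fst d \<and> (snd d = snd c + 1 \<or> snd c = snd d + 1) \<or>
     snd c = snd d \<and> (fst d = fst c + 1 \<or> fst c = fst d + 1)"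

text \<open>The residues are taken over the integers, since subtraction on \<^typ>\<open>nat\<close> truncates.\<close>

definition symbol_dist :: "nat \<Rightarrow> nat \<Rightarrow> nat \<Rightarrow> int" where
  "symbol_dist n u v = min ((int u - int v) mod int n) ((int v - int u) mod int n)"

text \<open>Meaningful for \<open>n \<ge> 2\<close>: for smaller orders there are no adjacent cells.\<close>

definition inner_distance :: "nat \<Rightarrow> (nat \<Rightarrow> nat \<Rightarrow> nat) \<Rightarrow> int" where
  "inner_distance n L =
     Min {symbol_dist n (L (fst c) (snd c)) (L (fst d) (snd d)) | c d.
            c \<in> {1..n} \<times> {1..n} \<and> d \<in> {1..n} \<times> {1..n} \<and> adjacent c d}"

text \<open>
  The set below is finite for \<open>a * b \<ge> 2\<close>, because every inner distance then lies in
  \<open>{0..<a * b}\<close>, although the functions \<open>L\<close> themselves range over an infinite type.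
\<close>

definition MiD :: "nat \<Rightarrow> nat \<Rightarrow> int" where
  "MiD a b = Max {inner_distance (a * b) L | L. sudoku_latin_square a b L}"

end

theory Submission
  imports Defs "HOL-Number_Theory.Cong"
begin

text \<open>
  Write \<open>b = 2 * m + 1\<close> and \<open>n = a * b\<close>.  The bound to reach is \<open>a * m\<close>, and two symbols have
  distance at least \<open>a * m\<close> exactly when their difference modulo \<open>n\<close> lies in the window from
  \<open>a * m\<close> to \<open>a * m + a\<close>, which is symmetric under negation modulo \<open>n\<close>.

  The square is a cyclic sum: up to the shift by one, the entry in row \<open>i\<close> and column \<open>j\<close> is
  \<open>r i + h j\<close> modulo \<open>n\<close>.  Then neighbours differ by a step of \<open>r\<close> or of \<open>h\<close>, so it suffices
  that all steps of the two sequences lie in the window; and the Latin property says that both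
  sequences are injective modulo \<open>n\<close>.  For the columns, \<open>h j = a * m * j + j div b\<close> has
  steps \<open>a * m\<close> and \<open>a * m + 1\<close>.  Over one band of \<open>b\<close> columns it runs through a single residue
  class modulo \<open>a\<close>, because \<open>m\<close> is invertible modulo \<open>b\<close>; hence a block is filled correctly
  as soon as \<open>r\<close> takes \<open>a\<close> different residues modulo \<open>a\<close> on each band of \<open>a\<close> rows.

  For the rows take \<open>r i = (a * m + e) * i\<close> with \<open>e \<le> a\<close>.  This works when \<open>a * m + e\<close> is
  coprime to \<open>a\<close>, for the bands, and also to \<open>b\<close>, for injectivity modulo \<open>n\<close>.  Because \<open>2 * (a * m + e)\<close> and \<open>2 * e - a\<close> agree modulo the odd
  number \<open>b\<close>, this amounts to \<open>e\<close> coprime to \<open>a\<close> and \<open>2 * e - a\<close> coprime to \<open>b\<close>, and there is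
  an \<open>e\<close> just above \<open>a / 2\<close> for which \<open>2 * e - a\<close> is 1, 2 or 4.  Only \<open>a = 2\<close> leaves no room
  for such an \<open>e\<close>; there the steps of \<open>r\<close> alternate between \<open>b\<close> and \<open>b - 1\<close>, so that
  the row bands receive the pairs \<open>{- k, b - k}\<close>.
\<close>

section \<open>Inner distance\<close>

lemma symbol_dist_bounds:
  assumes "0 < n"
  shows "0 \<le> symbol_dist n u v" and "symbol_dist n u v < int n"
  using assms by (auto simp: symbol_dist_def min_def)

lemma symbol_dist_commute: "symbol_dist n u v = symbol_dist n v u"
  by (simp add: symbol_dist_def min.commute)

text \<open>
  The residues of the two differences are \<open>d\<close> and \<open>n - d\<close>, so both hypotheses on \<open>d\<close> are the
  same bound seen from either side.
\<close>

lemma symbol_dist_ge: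
  assumes step: "[v = u + d] (mod n)" and "lo \<le> d" "d + lo \<le> n" "0 < n"
  shows "int lo \<le> symbol_dist n u v"
proof (cases "lo = 0")
  case True
  then show ?thesis using symbol_dist_bounds(1)[OF \<open>0 < n\<close>] by simp
next
  case False
  then have d: "0 < d" "d < n" using assms by auto
  have "[int v = int u + int d] (mod int n)"
    using step by (metis cong_int_iff of_nat_add)
  then have c: "[int v - int u = int d] (mod int n)"
    by (simp add: cong_iff_dvd_diff algebra_simps)
  then have vu: "(int v - int u) mod int n = int d"
    using d by (simp add: cong_def)
  have "[int u - int v = int n - int d] (mod int n)"
  proof -
    have "int n dvd (int v - int u - int d)" using c by (simp add: cong_iff_dvd_diff)
    then have "int n dvd - (int v - int u - int d) - int n"
      by (meson dvd_diff dvd_minus_iff dvd_refl)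
    then show ?thesis by (simp add: cong_iff_dvd_diff algebra_simps)
  qed
  moreover have "(int n - int d) mod int n = int n - int d"
    using d by (intro mod_pos_pos_trivial) auto
  ultimately have "(int u - int v) mod int n = int n - int d"
    unfolding cong_def by (rule trans)
  then show ?thesis using vu assms(2,3) by (simp add: symbol_dist_def)
qed

lemma inner_distance_set:
  fixes n :: nat and L :: "nat \<Rightarrow> nat \<Rightarrow> nat"
  defines "D \<equiv> {symbol_dist n (L (fst c) (snd c)) (L (fst d) (snd d)) | c d.
            c \<in> {1..n} \<times> {1..n} \<and> d \<in> {1..n} \<times> {1..n} \<and> adjacent c d}"
  assumes "2 \<le> n"
  shows "finite D" and "D \<noteq> {}"
proof -
  have "D \<subseteq> {0..<int n}"
    unfolding D_def using symbol_dist_bounds[of n] assms(2) by auto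
  then show "finite D" by (rule finite_subset) simp
  have "adjacent (1, 1) (1, 2)" by (simp add: adjacent_def)
  moreover have "(1, 1) \<in> {1..n} \<times> {1..n}" "(1, 2) \<in> {1..n} \<times> {1..n}" using assms(2) by auto
  ultimately show "D \<noteq> {}" unfolding D_def by blast
qed

text \<open>
  These bounds do not depend on \<open>L\<close>, which makes the set of inner distances finite although there
  are infinitely many arrays; only so does \<^const>\<open>MiD\<close> dominate its members.
\<close>

lemma inner_distance_bounds:
  assumes "2 \<le> n"
  shows "0 \<le> inner_distance n L" and "inner_distance n L < int n"
proof -
  have "inner_distance n L \<in> {symbol_dist n (L (fst c) (snd c)) (L (fst d) (snd d)) | c d.
            c \<in> {1..n} \<times> {1..n} \<and> d \<in> {1..n} \<times> {1..n} \<and> adjacent c d}"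
    unfolding inner_distance_def by (rule Min_in) (rule inner_distance_set[OF assms])+
  then show "0 \<le> inner_distance n L" "inner_distance n L < int n"
    using symbol_dist_bounds[of n] assms by auto
qed

lemma inner_distance_geI:
  assumes "2 \<le> n"
    and vertical: "\<And>i j. \<lbrakk>1 \<le> i; i < n; 1 \<le> j; j \<le> n\<rbrakk> \<Longrightarrow> x \<le> symbol_dist n (L i j) (L (i + 1) j)"
    and horizontal: "\<And>i j. \<lbrakk>1 \<le> i; i \<le> n; 1 \<le> j; j < n\<rbrakk> \<Longrightarrow> x \<le> symbol_dist n (L i j) (L i (j + 1))"
  shows "x \<le> inner_distance n L"
proof -
  have "x \<le> symbol_dist n (L (fst c) (snd c)) (L (fst d) (snd d))"
    if "c \<in> {1..n} \<times> {1..n}" "d \<in> {1..n} \<times> {1..n}" "adjacent c d" for c d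
    using that vertical[of "fst c" "snd c"] vertical[of "fst d" "snd d"]
      horizontal[of "fst c" "snd c"] horizontal[of "fst d" "snd d"]
    by (auto simp: adjacent_def symbol_dist_commute[of n "L (fst c) (snd c)"])
  then show ?thesis
    unfolding inner_distance_def
    by (subst Min_ge_iff) (use inner_distance_set[OF assms(1)] in auto)
qed

lemma inner_distance_le_MiD:
  assumes "2 \<le> a * b" "sudoku_latin_square a b L"
  shows "inner_distance (a * b) L \<le> MiD a b"
proof -
  have "{inner_distance (a * b) L | L. sudoku_latin_square a b L} \<subseteq> {0..<int (a * b)}"
    using inner_distance_bounds[OF assms(1)] by auto
  then have "finite {inner_distance (a * b) L | L. sudoku_latin_square a b L}"
    by (rule finite_subset) simp
  then show ?thesis unfolding MiD_def using assms(2) by (auto intro!: Max_ge)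
qed

section \<open>Cyclic sums of a row sequence and a column sequence\<close>

text \<open>
  The sequences are indexed from 0 and the array from 1, as are the symbols.
\<close>

definition cyclic_sum :: "nat \<Rightarrow> (nat \<Rightarrow> nat) \<Rightarrow> (nat \<Rightarrow> nat) \<Rightarrow> nat \<Rightarrow> nat \<Rightarrow> nat" where
  "cyclic_sum n r h i j = (r (i - 1) + h (j - 1)) mod n + 1"

lemma cyclic_sum_mem: "0 < n \<Longrightarrow> cyclic_sum n r h i j \<in> {1..n}"
  by (simp add: cyclic_sum_def Suc_leI)

lemma cyclic_sum_eq_iff:
  "cyclic_sum n r h i j = cyclic_sum n r h i' j' \<longleftrightarrow>
     [r (i - 1) + h (j - 1) = r (i' - 1) + h (j' - 1)] (mod n)"
  by (simp add: cyclic_sum_def cong_def)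

lemma cyclic_sum_cong: "[cyclic_sum n r h i j = r (i - 1) + h (j - 1) + 1] (mod n)"
  by (simp add: cyclic_sum_def cong_def mod_simps)

lemma latin_square_cyclic_sum:
  assumes "0 < n" and r: "inj_on (\<lambda>i. r i mod n) {..<n}" and h: "inj_on (\<lambda>j. h j mod n) {..<n}"
  shows "latin_square n (cyclic_sum n r h)"
proof -
  have "inj_on (\<lambda>j. cyclic_sum n r h i j) {1..n}" for i
  proof (rule inj_onI)
    fix j j' assume j: "j \<in> {1..n}" "j' \<in> {1..n}" "cyclic_sum n r h i j = cyclic_sum n r h i j'"
    from j(3) have "[h (j - 1) = h (j' - 1)] (mod n)"
      by (simp add: cyclic_sum_eq_iff cong_add_lcancel_nat)
    then have "h (j - 1) mod n = h (j' - 1) mod n" by (simp add: cong_def)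
    then have "j - 1 = j' - 1" by (rule inj_onD[OF h]) (use j in auto)
    then show "j = j'" using j(1,2) unfolding atLeastAtMost_iff by linarith
  qed
  moreover have "inj_on (\<lambda>i. cyclic_sum n r h i j) {1..n}" for j
  proof (rule inj_onI)
    fix i i' assume i: "i \<in> {1..n}" "i' \<in> {1..n}" "cyclic_sum n r h i j = cyclic_sum n r h i' j"
    from i(3) have "[r (i - 1) = r (i' - 1)] (mod n)"
      by (simp add: cyclic_sum_eq_iff cong_add_rcancel_nat)
    then have "r (i - 1) mod n = r (i' - 1) mod n" by (simp add: cong_def)
    then have "i - 1 = i' - 1" by (rule inj_onD[OF r]) (use i in auto)
    then show "i = i'" using i(1,2) unfolding atLeastAtMost_iff by linarith
  qed
  moreover have "bij_betw f {1..n} {1..n}"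
    if "inj_on f {1..n}" "\<And>i. f i \<in> {1..n}" for f :: "nat \<Rightarrow> nat"
    using that by (intro bij_betw_imageI endo_inj_surj) auto
  ultimately show ?thesis
    unfolding latin_square_def using cyclic_sum_mem[OF assms(1), of r h] by blast
qed

lemma inner_distance_cyclic_sum_ge:
  assumes n: "2 \<le> n"
    and r: "\<And>i. \<exists>d. lo \<le> d \<and> d + lo \<le> n \<and> [r (i + 1) = r i + d] (mod n)"
    and h: "\<And>j. \<exists>d. lo \<le> d \<and> d + lo \<le> n \<and> [h (j + 1) = h j + d] (mod n)"
  shows "int lo \<le> inner_distance n (cyclic_sum n r h)"
proof (rule inner_distance_geI[OF n])
  fix i j :: nat assume ij: "1 \<le> i"
  obtain d where d: "lo \<le> d" "d + lo \<le> n" "[r (i - 1 + 1) = r (i - 1) + d] (mod n)"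
    using r by blast
  have "[cyclic_sum n r h (i + 1) j = r i + h (j - 1) + 1] (mod n)"
    using cyclic_sum_cong[of n r h "i + 1" j] by simp
  also have "[r i + h (j - 1) + 1 = r (i - 1) + d + h (j - 1) + 1] (mod n)"
    using d(3) ij by (intro cong_add) auto
  also have "r (i - 1) + d + h (j - 1) + 1 = r (i - 1) + h (j - 1) + 1 + d" by simp
  also have "[\<dots> = cyclic_sum n r h i j + d] (mod n)"
    by (intro cong_add cong_sym[OF cyclic_sum_cong]) auto
  finally show "int lo \<le> symbol_dist n (cyclic_sum n r h i j) (cyclic_sum n r h (i + 1) j)"
    by (rule symbol_dist_ge) (use d n in auto)
next
  fix i j :: nat assume ij: "1 \<le> j"
  obtain d where d: "lo \<le> d" "d + lo \<le> n" "[h (j - 1 + 1) = h (j - 1) + d] (mod n)"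
    using h by blast
  have "[cyclic_sum n r h i (j + 1) = r (i - 1) + h j + 1] (mod n)"
    using cyclic_sum_cong[of n r h i "j + 1"] by simp
  also have "[r (i - 1) + h j + 1 = r (i - 1) + (h (j - 1) + d) + 1] (mod n)"
    using d(3) ij by (intro cong_add) auto
  also have "r (i - 1) + (h (j - 1) + d) + 1 = r (i - 1) + h (j - 1) + 1 + d" by simp
  also have "[\<dots> = cyclic_sum n r h i j + d] (mod n)"
    by (intro cong_add cong_sym[OF cyclic_sum_cong]) auto
  finally show "int lo \<le> symbol_dist n (cyclic_sum n r h i j) (cyclic_sum n r h i (j + 1))"
    by (rule symbol_dist_ge) (use d n in auto)
qed

section \<open>The column sequence\<close>

text \<open>
  One increment of \<open>j div b\<close> per band moves each band of columns to a new residue class modulo \<open>a\<close>.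
\<close>

definition column_seq :: "nat \<Rightarrow> nat \<Rightarrow> nat \<Rightarrow> nat \<Rightarrow> nat" where
  "column_seq a b m j = a * m * j + j div b"

lemma cong_mult_inj_lessThan:
  fixes u b t t' :: nat
  assumes "[u * t = u * t'] (mod b)" "coprime u b" "t < b" "t' < b"
  shows "t = t'"
  using assms by (simp add: cong_mult_lcancel_nat cong_less_modulus_unique_nat)

lemma inj_column_seq:
  assumes "0 < a" "coprime m b"
  shows "inj_on (\<lambda>j. column_seq a b m j mod (a * b)) {..<a * b}"
proof (rule inj_onI)
  fix j j' assume j: "j \<in> {..<a * b}" "j' \<in> {..<a * b}"
    and "column_seq a b m j mod (a * b) = column_seq a b m j' mod (a * b)"
  then have c: "[a * m * j + j div b = a * m * j' + j' div b] (mod a * b)"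
    by (simp add: cong_def column_seq_def)
  have "0 < b" using j by (cases b) auto
  have "[a * m * j + j div b = a * m * j' + j' div b] (mod a)"
    using c by (rule cong_modulus_mult_nat)
  then have "[j div b = j' div b] (mod a)"
    by (simp add: cong_def mult.assoc)
  moreover have "j div b < a" "j' div b < a"
    using j by (simp_all add: less_mult_imp_div_less)
  ultimately have eq: "j div b = j' div b" by (simp add: cong_def)
  then have "[a * (m * j) = a * (m * j')] (mod a * b)"
    using c by (simp add: cong_add_rcancel_nat mult.assoc)
  then have "[m * j = m * j'] (mod b)"
    using assms(1) by (simp add: cong_def mod_mult_mult1)
  then have "[j = j'] (mod b)" using assms(2) by (simp add: cong_mult_lcancel_nat)
  then have "j mod b = j' mod b" by (simp add: cong_def)
  then show "j = j'" using eq by (metis div_mult_mod_eq)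
qed

lemma column_seq_step:
  assumes "0 < a" "b = 2 * m + 1"
  shows "\<exists>d. a * m \<le> d \<and> d + a * m \<le> a * b \<and>
           [column_seq a b m (j + 1) = column_seq a b m j + d] (mod a * b)"
proof -
  have "(j + 1) div b = j div b \<or> (j + 1) div b = j div b + 1"
    by (simp add: div_Suc)
  then consider "column_seq a b m (j + 1) = column_seq a b m j + a * m"
    | "column_seq a b m (j + 1) = column_seq a b m j + (a * m + 1)"
    by (auto simp: column_seq_def algebra_simps)
  then show ?thesis
  proof cases
    case 1 then show ?thesis
      using assms by (intro exI[of _ "a * m"]) (simp add: algebra_simps)
  next
    case 2 then show ?thesis
      using assms by (intro exI[of _ "a * m + 1"]) (simp add: algebra_simps)
  qed
qed

text \<open>
  Inside a block all values of the column sequence agree modulo \<open>a\<close>.  So the residue of a symbol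
  modulo \<open>a\<close> determines its row, and then \<open>m\<close> being invertible modulo \<open>b\<close> determines its column.
\<close>

lemma sudoku_cyclic_sum:
  assumes a: "0 < a" and b: "0 < b" and m: "coprime m b"
    and r: "inj_on (\<lambda>i. r i mod (a * b)) {..<a * b}"
    and band: "\<And>k. inj_on (\<lambda>s. r (k * a + s) mod a) {..<a}"
  shows "sudoku_latin_square a b (cyclic_sum (a * b) r (column_seq a b m))"
proof -
  let ?h = "column_seq a b m"
  let ?L = "cyclic_sum (a * b) r ?h"
  have "bij_betw (\<lambda>(i, j). ?L i j)
          ({k * a + 1..(k + 1) * a} \<times> {l * b + 1..(l + 1) * b}) {1..a * b}" for k l
  proof -
    let ?B = "{k * a + 1..(k + 1) * a} \<times> {l * b + 1..(l + 1) * b}"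
    have inj: "inj_on (\<lambda>(i, j). ?L i j) ?B"
    proof (rule inj_onI, clarify)
      fix i j i' j'
      assume i: "i \<in> {k * a + 1..(k + 1) * a}" "i' \<in> {k * a + 1..(k + 1) * a}"
        and j: "j \<in> {l * b + 1..(l + 1) * b}" "j' \<in> {l * b + 1..(l + 1) * b}"
        and eq: "?L i j = ?L i' j'"
      define s s' where "s = i - (k * a + 1)" and "s' = i' - (k * a + 1)"
      have s: "s < a" "s' < a" "i = k * a + s + 1" "i' = k * a + s' + 1"
        using i by (auto simp: s_def s'_def)
      define t t' where "t = j - (l * b + 1)" and "t' = j' - (l * b + 1)"
      have t: "t < b" "t' < b" "j = l * b + t + 1" "j' = l * b + t' + 1"
        using j by (auto simp: t_def t'_def)
      have h: "?h (j - 1) = a * (m * t) + (a * m * (l * b) + l)"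
        "?h (j' - 1) = a * (m * t') + (a * m * (l * b) + l)"
        using t by (simp_all add: column_seq_def algebra_simps)
      have "[r (k * a + s) + (a * (m * t) + (a * m * (l * b) + l)) =
             r (k * a + s') + (a * (m * t') + (a * m * (l * b) + l))] (mod a * b)"
        using eq h s(3,4) by (simp add: cyclic_sum_eq_iff)
      then have c: "[r (k * a + s) + a * (m * t) = r (k * a + s') + a * (m * t')] (mod a * b)"
        by (metis add.assoc cong_add_rcancel_nat)
      then have "[r (k * a + s) + a * (m * t) = r (k * a + s') + a * (m * t')] (mod a)"
        by (rule cong_modulus_mult_nat)
      then have "r (k * a + s) mod a = r (k * a + s') mod a"
        by (simp add: cong_def)
      then have ss: "s = s'" using s by (auto intro: inj_onD[OF band[of k]])
      then have "[a * (m * t) = a * (m * t')] (mod a * b)"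
        using c by (simp add: cong_add_lcancel_nat)
      then have "[m * t = m * t'] (mod b)"
        using a by (simp add: cong_def mod_mult_mult1)
      then have "t = t'" using m t by (rule_tac cong_mult_inj_lessThan)
      then show "i = i' \<and> j = j'" using ss s t by simp
    qed
    have "(\<lambda>(i, j). ?L i j) ` ?B \<subseteq> {1..a * b}"
      using cyclic_sum_mem[of "a * b" r ?h] a b by auto
    moreover have "card ((\<lambda>(i, j). ?L i j) ` ?B) = card {1..a * b}"
      unfolding card_image[OF inj] by (simp add: card_cartesian_product)
    ultimately show ?thesis
      using inj by (simp add: bij_betw_def card_subset_eq)
  qed
  then show ?thesis
    unfolding sudoku_latin_square_def
    using latin_square_cyclic_sum[OF _ r inj_column_seq[OF a m]] a b by simp
qed

section \<open>Row sequences\<close>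

text \<open>
  The \<open>e\<close> below is the least number above \<open>a / 2\<close> for which \<open>e\<close> is coprime to \<open>a\<close>; the excess
  \<open>2 * e - a\<close> is then 1, 2 or 4 according to the residue of \<open>a\<close> modulo 4.
\<close>

lemma coprime_multiplier:
  fixes a b m :: nat
  assumes "0 < a" "a \<noteq> 2" "b = 2 * m + 1"
  obtains e where "e \<le> a" "coprime (a * m + e) (a * b)"
proof -
  have "\<exists>e w. e \<le> a \<and> coprime e a \<and> 2 * e = a + w \<and> coprime w b"
  proof -
    consider k where "a = 2 * k + 1" | k where "a = 4 * k" "0 < k" | k where "a = 4 * k + 2" "0 < k"
      using assms(1,2) by atomize_elim presburger
    then show ?thesis
    proof cases
      case 1
      have "coprime (k + 1) (2 * k + 1)"
      proof (rule coprimeI)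
        fix c assume "c dvd k + 1" "c dvd 2 * k + 1"
        then have "c dvd 2 * (k + 1) - (2 * k + 1)" by (meson dvd_diff_nat dvd_mult)
        then show "is_unit c" by simp
      qed
      then show ?thesis using 1 by (intro exI[of _ "k + 1"] exI[of _ 1]) auto
    next
      case 2
      have "coprime (2 * k + 1) (4 * k)"
      proof (rule coprimeI)
        fix c assume c: "c dvd 2 * k + 1" "c dvd 4 * k"
        then have "c dvd 2 * (2 * k + 1) - 4 * k" by (meson dvd_diff_nat dvd_mult)
        then have "c dvd 2" by simp
        then have "c dvd 2 * k" by simp
        then show "is_unit c" using c(1) by (meson dvd_add_right_iff)
      qed
      moreover have "coprime 2 b" using assms(3) by simp
      ultimately show ?thesis using 2 by (intro exI[of _ "2 * k + 1"] exI[of _ 2]) auto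
    next
      case 3
      have "coprime (2 * k + 3) (4 * k + 2)"
      proof (rule coprimeI)
        fix c assume c: "c dvd 2 * k + 3" "c dvd 4 * k + 2"
        then have "c dvd 2 * (2 * k + 3) - (4 * k + 2)" by (meson dvd_diff_nat dvd_mult)
        then have "c dvd 2 ^ 2" by simp
        moreover have "coprime c (2 ^ 2)"
        proof -
          have "odd c" using c(1) by (meson dvd_trans even_add even_mult_iff even_numeral odd_numeral)
          then show ?thesis by (simp only: coprime_power_right_iff) simp
        qed
        ultimately show "is_unit c" by (meson coprime_common_divisor dvd_refl)
      qed
      moreover have "coprime 4 b"
      proof -
        have "coprime (2 ^ 2) b" using assms(3) by (simp only: coprime_power_left_iff) simp
        then show ?thesis by simp
      qed
      ultimately show ?thesis using 3 by (intro exI[of _ "2 * k + 3"] exI[of _ 4]) auto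
    qed
  qed
  then obtain e w where e: "e \<le> a" "coprime e a" "2 * e = a + w" "coprime w b" by blast
  have "coprime (a * m + e) a"
    using e(2) by (metis coprime_iff_gcd_eq_1 gcd.commute gcd_add_mult add.commute mult.commute)
  moreover have "coprime (a * m + e) b"
  proof (rule coprimeI)
    fix c assume c: "c dvd a * m + e" "c dvd b"
    \<comment> \<open>modulo \<open>b\<close>, doubling \<open>a * m\<close> gives \<open>- a\<close>\<close>
    have "2 * (a * m + e) = a * b + w" using e(3) assms(3) by (simp add: algebra_simps)
    then have "c dvd a * b + w" using c(1) by (metis dvd_mult)
    then have "c dvd w" using c(2) by (simp add: dvd_add_right_iff)
    then show "is_unit c" using c(2) e(4) by (meson coprime_common_divisor)
  qed
  ultimately show thesis using that e(1) by simp
qed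

lemma row_seq_linear:
  fixes a b v :: nat
  assumes v: "coprime v (a * b)"
  shows "inj_on (\<lambda>i. v * i mod (a * b)) {..<a * b}"
    and "inj_on (\<lambda>s. v * (k * a + s) mod a) {..<a}"
proof -
  show "inj_on (\<lambda>i. v * i mod (a * b)) {..<a * b}"
    using cong_mult_inj_lessThan[OF _ v] by (auto intro!: inj_onI simp: cong_def)
  show "inj_on (\<lambda>s. v * (k * a + s) mod a) {..<a}"
  proof (rule inj_onI)
    fix s s' assume s: "s \<in> {..<a}" "s' \<in> {..<a}"
      and eq: "v * (k * a + s) mod a = v * (k * a + s') mod a"
    have "[v * k * a + v * s = v * k * a + v * s'] (mod a)"
      using eq by (simp add: cong_def algebra_simps)
    then have "[v * s = v * s'] (mod a)" by (simp add: cong_add_lcancel_nat)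
    then show "s = s'" using cong_mult_inj_lessThan[of v s s' a] v s by auto
  qed
qed

text \<open>
  The factor \<open>2 * b - 1\<close> stands for \<open>- 1\<close> modulo \<open>2 * b\<close>, so that rows \<open>2 * k\<close> and \<open>2 * k + 1\<close>
  receive \<open>- k\<close> and \<open>b - k\<close>.
\<close>

definition row_seq_two :: "nat \<Rightarrow> nat \<Rightarrow> nat" where
  "row_seq_two b i = b * i + (2 * b - 1) * (i div 2)"

lemma inj_row_seq_two:
  assumes "0 < b"
  shows "inj_on (\<lambda>i. row_seq_two b i mod (2 * b)) {..<2 * b}"
proof (rule inj_onI)
  fix i i' assume i: "i \<in> {..<2 * b}" "i' \<in> {..<2 * b}"
    and "row_seq_two b i mod (2 * b) = row_seq_two b i' mod (2 * b)"
  then have c: "[b * i + (2 * b - 1) * (i div 2) = b * i' + (2 * b - 1) * (i' div 2)] (mod b * 2)"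
    by (simp add: cong_def row_seq_two_def mult.commute)
  then have "[b * i + (2 * b - 1) * (i div 2) = b * i' + (2 * b - 1) * (i' div 2)] (mod b)"
    by (rule cong_modulus_mult_nat)
  then have "[(2 * b - 1) * (i div 2) = (2 * b - 1) * (i' div 2)] (mod b)"
    by (simp add: cong_def)
  moreover have "coprime (2 * b - 1) b"
  proof (rule coprimeI)
    fix c assume "c dvd 2 * b - 1" "c dvd b"
    then have "c dvd 2 * b - (2 * b - 1)" by (meson dvd_diff_nat dvd_mult)
    then show "is_unit c" using assms by simp
  qed
  moreover have "i div 2 < b" "i' div 2 < b" using i by auto
  ultimately have eq: "i div 2 = i' div 2" by (rule cong_mult_inj_lessThan)
  then have "[b * i = b * i'] (mod b * 2)" using c by (simp add: cong_add_rcancel_nat)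
  then have "i mod 2 = i' mod 2" using assms by (simp add: cong_def mod_mult_mult1)
  then show "i = i'" using eq by (metis div_mult_mod_eq)
qed

lemma row_seq_two_band:
  assumes "odd b"
  shows "inj_on (\<lambda>s. row_seq_two b (k * 2 + s) mod 2) {..<2}"
proof -
  have "row_seq_two b (k * 2 + 1) = row_seq_two b (k * 2) + b"
    by (simp add: row_seq_two_def)
  then have "row_seq_two b (k * 2 + 1) mod 2 \<noteq> row_seq_two b (k * 2) mod 2"
    using assms by presburger
  then show ?thesis by (auto simp: inj_on_def less_2_cases_iff)
qed

lemma row_seq_two_step:
  assumes "b = 2 * m + 1"
  shows "\<exists>d. 2 * m \<le> d \<and> d + 2 * m \<le> 2 * b \<and>
           [row_seq_two b (i + 1) = row_seq_two b i + d] (mod 2 * b)"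
proof (cases "even i")
  case True
  then have "row_seq_two b (i + 1) = row_seq_two b i + b"
    by (simp add: row_seq_two_def)
  then show ?thesis using assms by (intro exI[of _ b]) simp
next
  case False
  then have "(i + 1) div 2 = i div 2 + 1" by (auto elim!: oddE)
  then have "row_seq_two b (i + 1) = row_seq_two b i + 2 * m + 2 * b"
    using assms by (simp add: row_seq_two_def algebra_simps)
  then have "[row_seq_two b (i + 1) = row_seq_two b i + 2 * m] (mod 2 * b)"
    by (simp add: cong_def)
  then show ?thesis using assms by (intro exI[of _ "2 * m"]) simp
qed

lemma row_seq_exists:
  fixes a b m :: nat
  assumes "0 < a" "b = 2 * m + 1"
  obtains r where "inj_on (\<lambda>i. r i mod (a * b)) {..<a * b}"
    "\<And>k. inj_on (\<lambda>s. r (k * a + s) mod a) {..<a}"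
    "\<And>i. \<exists>d. a * m \<le> d \<and> d + a * m \<le> a * b \<and> [r (i + 1) = r i + d] (mod a * b)"
proof (cases "a = 2")
  case True
  show thesis
    by (rule that[of "row_seq_two b"])
      (use True assms(2) inj_row_seq_two[of b] row_seq_two_band[of b] row_seq_two_step[of b m] in auto)
next
  case False
  then obtain e where e: "e \<le> a" "coprime (a * m + e) (a * b)"
    using coprime_multiplier assms by metis
  have "\<exists>d. a * m \<le> d \<and> d + a * m \<le> a * b \<and>
          [(a * m + e) * (i + 1) = (a * m + e) * i + d] (mod a * b)" for i
    using e(1) assms(2) by (intro exI[of _ "a * m + e"]) (simp add: algebra_simps)
  then show thesis using that[of "\<lambda>i. (a * m + e) * i"] row_seq_linear[OF e(2)] by blast
qed

section \<open>The lower bound\<close>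

theorem theorem4p4:
  fixes a b n :: nat
  assumes "0 < a" and "0 < b" and "a \<le> b"
    and "n = a * b" and "n \<ge> 2"
    and "odd b"
  shows "real_of_int (MiD a b) \<ge> (real n - real a) / 2"
proof -
  obtain m where m: "b = 2 * m + 1" using \<open>odd b\<close> by (elim oddE)
  have "coprime m b"
  proof (rule coprimeI)
    fix c assume "c dvd m" "c dvd b"
    then have "c dvd b - 2 * m" by (meson dvd_diff_nat dvd_mult)
    then show "is_unit c" using m by simp
  qed
  obtain r where r: "inj_on (\<lambda>i. r i mod (a * b)) {..<a * b}"
    "\<And>k. inj_on (\<lambda>s. r (k * a + s) mod a) {..<a}"
    "\<And>i. \<exists>d. a * m \<le> d \<and> d + a * m \<le> a * b \<and> [r (i + 1) = r i + d] (mod a * b)"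
    using row_seq_exists[OF \<open>0 < a\<close> m] by metis
  let ?L = "cyclic_sum (a * b) r (column_seq a b m)"
  have "int (a * m) \<le> inner_distance (a * b) ?L"
    using inner_distance_cyclic_sum_ge r(3) column_seq_step[OF \<open>0 < a\<close> m] assms(4,5) by blast
  also have "\<dots> \<le> MiD a b"
    using inner_distance_le_MiD sudoku_cyclic_sum[OF assms(1,2) \<open>coprime m b\<close> r(1,2)] assms(4,5)
    by blast
  finally have "real (a * m) \<le> real_of_int (MiD a b)" by linarith
  moreover have "(real n - real a) / 2 = real (a * m)"
    using m assms(4) by (simp add: algebra_simps)
  ultimately show ?thesis by simp
qed

end
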